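(* Let $\mathbf{Vir}$ be the Virasoro algebra over $\mathbb{C}$. Then $$\mathrm{Q}\mathfrak{Der}(\mathbf{Vir}) = \mathfrak{Der}(\mathbf{Vir}) \oplus \mathfrak{Der}_{\frac12}(\mathbf{Vir}) \oplus \mathrm{Ann}^Q(\mathbf{Vir}).$$
   Context: All algebras and vector spaces are over $\mathbb{C}$. The Virasoro algebra $\mathbf{Vir}$ is the Lie algebra with basis $\{L_i, C\}_{i\in\mathbb{Z}}$, where $C$ is central and $[L_i,L_j]=(i-j)L_{i+j}+(i^3-i)\delta_{i+j,0}C$ ($\delta_{i+j,0}$ is the Kronecker delta). For a Lie algebra $\mathfrak{L}$: a linear map $f:\mathfrak{L}\to\mathfrak{L}$ is a quasi-derivation if there is a linear map $f':\mathfrak{L}\to\mathfrak{L}$ with $[f(x),y]+[x,f(y)]=f'([x,y])$ for all $x,y$; the space of quasi-derivations is $\mathrm{Q}\mathfrak{Der}(\mathfrak{L})$. For $\delta\in\mathbb{C}$, a linear map $\varphi:\mathfrak{L}\to\mathfrak{L}$ is a $\delta$-derivation if $\varphi([x,y])=\delta\big([\varphi(x),y]+[x,\varphi(y)]\big)$ for all $x,y$; the space of these is $\mathfrak{Der}_\delta(\mathfrak{L})$. $\mathfrak{Der}(\mathfrak{L})=\mathfrak{Der}_1(\mathfrak{L})$ is the space of derivations. $\mathrm{Ann}(\mathbf{Vir})=\langle C\rangle$ is the center, and $\mathrm{Ann}^Q(\mathbf{Vir})=\{g\in\mathrm{End}(\mathbf{Vir}) \mid g(\mathbf{Vir})\subseteq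 \langle C\rangle\}$, where $\mathrm{End}$ denotes all linear endomorphisms. $\oplus$ denotes the direct sum of vector spaces. *)

theory Defs
  imports Complex_Main "HOL-Library.Function_Algebras" "HOL-Library.Poly_Mapping"
begin

text \<open>
  The subspaces in the list \<open>Us\<close> form an internal direct sum decomposition of \<open>V\<close>:
  addition is a bijection from the Cartesian product of the \<open>Us\<close> onto \<open>V\<close>.
\<close>

definition (in vector_space) internal_direct_sum :: "'b set \<Rightarrow> 'b set list \<Rightarrow> bool" where
  "internal_direct_sum V Us \<longleftrightarrow>
     (\<forall>U\<in>set Us. subspace U) \<and> bij_betw sum_list (listset Us) V"

lemma (in vector_space) internal_direct_sum_3:
  "internal_direct_sum V [A, B, C] \<longleftrightarrow>
     subspace A \<and> subspace B \<and> subspace C \<and>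
     V = {a + b + c |a b c. a \<in> A \<and> b \<in> B \<and> c \<in> C} \<and>
     (\<forall>a\<in>A. \<forall>b\<in>B. \<forall>c\<in>C. a + b + c = 0 \<longrightarrow> a = 0 \<and> b = 0 \<and> c = 0)"
proof -
  have ls: "listset [A, B, C] = {[a, b, c] |a b c. a \<in> A \<and> b \<in> B \<and> c \<in> C}"
    by (auto simp: set_Cons_def)
  have img: "sum_list ` listset [A, B, C] = {a + b + c |a b c. a \<in> A \<and> b \<in> B \<and> c \<in> C}"
    unfolding ls by (fastforce simp: image_iff add.assoc)
  have inj: "inj_on sum_list (listset [A, B, C]) \<longleftrightarrow>
      (\<forall>a\<in>A. \<forall>b\<in>B. \<forall>c\<in>C. a + b + c = 0 \<longrightarrow> a = 0 \<and> b = 0 \<and> c = 0)"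
    (is "?I \<longleftrightarrow> ?R") if sub: "subspace A" "subspace B" "subspace C"
  proof
    assume I: ?I
    have "a = 0 \<and> b = 0 \<and> c = 0" if "a \<in> A" "b \<in> B" "c \<in> C" "a + b + c = 0" for a b c
    proof -
      have "[a, b, c] = [0, 0, 0]"
        by (rule inj_onD[OF I]) (use that sub in \<open>auto simp: set_Cons_def add.assoc subspace_0\<close>)
      then show ?thesis by simp
    qed
    then show ?R by blast
  next
    assume R: ?R
    show ?I
    proof (rule inj_onI)
      fix us vs assume "us \<in> listset [A, B, C]" "vs \<in> listset [A, B, C]"
        and eq: "sum_list us = sum_list vs"
      then obtain a b c a' b' c' where us: "us = [a, b, c]" "a \<in> A" "b \<in> B" "c \<in> C"
        and vs: "vs = [a', b', c']" "a' \<in> A" "b' \<in> B" "c' \<in> C"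
        unfolding ls by blast
      have "(a - a') + (b - b') + (c - c') = 0"
        using eq by (simp add: us vs algebra_simps)
      moreover have "a - a' \<in> A" "b - b' \<in> B" "c - c' \<in> C"
        using us vs sub by (auto intro: subspace_diff)
      ultimately have "a - a' = 0 \<and> b - b' = 0 \<and> c - c' = 0"
        using R by blast
      then show "us = vs" by (simp add: us vs)
    qed
  qed
  show ?thesis
    unfolding internal_direct_sum_def bij_betw_def img using inj by auto
qed

definition pointwise_scale ::
    "(complex \<Rightarrow> 'v \<Rightarrow> 'v) \<Rightarrow> complex \<Rightarrow> ('v \<Rightarrow> 'v) \<Rightarrow> 'v \<Rightarrow> 'v" where
  "pointwise_scale scl c f = (\<lambda>x. scl c (f x))"

locale lie_algebra = vector_space scale
  for scale :: "complex \<Rightarrow> 'v::ab_group_add \<Rightarrow> 'v" (infixr \<open>*s\<close> 75) +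
  fixes bracket :: "'v \<Rightarrow> 'v \<Rightarrow> 'v"
  assumes bracket_add_left: "bracket (x + y) z = bracket x z + bracket y z"
    and bracket_add_right: "bracket x (y + z) = bracket x y + bracket x z"
    and bracket_scale_left: "bracket (c *s x) y = c *s bracket x y"
    and bracket_scale_right: "bracket x (c *s y) = c *s bracket x y"
    and bracket_self: "bracket x x = 0"
    and jacobi: "bracket x (bracket y z) + bracket y (bracket z x) + bracket z (bracket x y) = 0"
begin

definition endomorphisms :: "('v \<Rightarrow> 'v) set" where
  "endomorphisms = {f. Vector_Spaces.linear scale scale f}"

definition quasi_derivations :: "('v \<Rightarrow> 'v) set" where
  "quasi_derivations = {f \<in> endomorphisms. \<exists>f' \<in> endomorphisms.
     \<forall>x y. bracket (f x) y + bracket x (f y) = f' (bracket x y)}"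

definition delta_derivations :: "complex \<Rightarrow> ('v \<Rightarrow> 'v) set" where
  "delta_derivations \<delta> = {\<phi> \<in> endomorphisms.
     \<forall>x y. \<phi> (bracket x y) = \<delta> *s (bracket (\<phi> x) y + bracket x (\<phi> y))}"

definition derivations :: "('v \<Rightarrow> 'v) set" where
  "derivations = delta_derivations 1"

definition Ann :: "'v set" where
  "Ann = {x. \<forall>y. bracket x y = 0}"

definition AnnQ :: "('v \<Rightarrow> 'v) set" where
  "AnnQ = {g \<in> endomorphisms. range g \<subseteq> Ann}"

text \<open>
  All maps from the Lie algebra to itself, with pointwise operations; its subspace of
  endomorphisms is where the sets of maps above live.
\<close>

sublocale maps: vector_space "pointwise_scale scale"
  by unfold_locales
    (auto simp: pointwise_scale_def fun_eq_iff scale_right_distrib scale_left_distrib)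

end

text \<open>
  The Virasoro algebra is realised as the free complex vector space on the index set
  of its basis, with the bracket extended bilinearly from the basis.
\<close>

datatype vir_index = LI int | CI

type_synonym vir = "vir_index \<Rightarrow>\<^sub>0 complex"

definition vir_scale :: "complex \<Rightarrow> vir \<Rightarrow> vir" where
  "vir_scale c = Poly_Mapping.map ((*) c)"

definition Vir_L :: "int \<Rightarrow> vir" where
  "Vir_L i = Poly_Mapping.single (LI i) 1"

definition Vir_C :: vir where
  "Vir_C = Poly_Mapping.single CI 1"

fun vir_basis_bracket :: "vir_index \<Rightarrow> vir_index \<Rightarrow> vir" where
  "vir_basis_bracket (LI i) (LI j) =
     vir_scale (of_int (i - j)) (Vir_L (i + j))
     + (if i + j = 0 then vir_scale (of_int (i ^ 3 - i)) Vir_C else 0)"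
| "vir_basis_bracket _ _ = 0"

definition vir_bracket :: "vir \<Rightarrow> vir \<Rightarrow> vir" where
  "vir_bracket x y =
     (\<Sum>a\<in>Poly_Mapping.keys x. \<Sum>b\<in>Poly_Mapping.keys y.
        vir_scale (Poly_Mapping.lookup x a * Poly_Mapping.lookup y b) (vir_basis_bracket a b))"

lemma lookup_vir_scale [simp]:
  "Poly_Mapping.lookup (vir_scale c x) k = c * Poly_Mapping.lookup x k"
  by (simp add: vir_scale_def Poly_Mapping.map.rep_eq when_def)

interpretation vir: vector_space vir_scale
  by unfold_locales (auto intro!: poly_mapping_eqI simp: lookup_add algebra_simps)

lemma vir_bracket_superset:
  assumes "finite A" "finite B" "Poly_Mapping.keys x \<subseteq> A" "Poly_Mapping.keys y \<subseteq> B"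
  shows "vir_bracket x y =
    (\<Sum>a\<in>A. \<Sum>b\<in>B.
       vir_scale (Poly_Mapping.lookup x a * Poly_Mapping.lookup y b) (vir_basis_bracket a b))"
proof -
  have "vir_bracket x y = (\<Sum>a\<in>Poly_Mapping.keys x. \<Sum>b\<in>B.
       vir_scale (Poly_Mapping.lookup x a * Poly_Mapping.lookup y b) (vir_basis_bracket a b))"
    unfolding vir_bracket_def
    by (intro sum.cong refl sum.mono_neutral_left) (use assms in \<open>auto simp: in_keys_iff\<close>)
  also have "\<dots> = (\<Sum>a\<in>A. \<Sum>b\<in>B.
       vir_scale (Poly_Mapping.lookup x a * Poly_Mapping.lookup y b) (vir_basis_bracket a b))"
    by (intro sum.mono_neutral_left) (use assms in \<open>auto simp: in_keys_iff\<close>)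
  finally show ?thesis .
qed

lemma vir_bracket_add_left: "vir_bracket (x + y) z = vir_bracket x z + vir_bracket y z"
proof -
  let ?A = "Poly_Mapping.keys x \<union> Poly_Mapping.keys y"
  have "Poly_Mapping.keys (x + y) \<subseteq> ?A" by (rule Poly_Mapping.keys_add)
  then show ?thesis
    by (simp add: vir_bracket_superset[where A = ?A and B = "Poly_Mapping.keys z"]
        lookup_add vir.scale_left_distrib distrib_right sum.distrib)
qed

lemma vir_bracket_scale_left: "vir_bracket (vir_scale c x) y = vir_scale c (vir_bracket x y)"
proof -
  have "Poly_Mapping.keys (vir_scale c x) \<subseteq> Poly_Mapping.keys x"
    by (auto simp: in_keys_iff)
  then show ?thesis
    by (simp add: vir_bracket_superset[where A = "Poly_Mapping.keys x" and B = "Poly_Mapping.keys y"]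
        vir.scale_sum_right mult.assoc)
qed

lemma vir_basis_bracket_swap: "vir_basis_bracket a b = - vir_basis_bracket b a"
proof (cases a; cases b)
  fix i j assume ab: "a = LI i" "b = LI j"
  show ?thesis
  proof (cases "i + j = 0")
    case True
    then have "i = - j" by simp
    then show ?thesis
      by (auto intro!: poly_mapping_eqI simp: ab lookup_add algebra_simps)
  next
    case False
    then show ?thesis
      by (auto intro!: poly_mapping_eqI simp: ab lookup_add algebra_simps)
  qed
qed auto

lemma vir_bracket_swap: "vir_bracket x y = - vir_bracket y x"
proof -
  have "vir_bracket x y = (\<Sum>b\<in>Poly_Mapping.keys y. \<Sum>a\<in>Poly_Mapping.keys x.
      vir_scale (Poly_Mapping.lookup x a * Poly_Mapping.lookup y b) (vir_basis_bracket a b))"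
    unfolding vir_bracket_def by (rule sum.swap)
  also have "\<dots> = (\<Sum>b\<in>Poly_Mapping.keys y. \<Sum>a\<in>Poly_Mapping.keys x.
      - vir_scale (Poly_Mapping.lookup y b * Poly_Mapping.lookup x a) (vir_basis_bracket b a))"
    by (intro sum.cong refl, subst vir_basis_bracket_swap) (simp add: mult.commute)
  finally show ?thesis
    by (simp add: vir_bracket_def sum_negf)
qed

lemma vir_bracket_add_right: "vir_bracket x (y + z) = vir_bracket x y + vir_bracket x z"
  by (metis vir_bracket_swap vir_bracket_add_left minus_add_distrib)

lemma vir_bracket_scale_right: "vir_bracket x (vir_scale c y) = vir_scale c (vir_bracket x y)"
  by (metis vir_bracket_swap vir_bracket_scale_left vir.scale_minus_right)

lemma vir_bracket_self: "vir_bracket x x = 0"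
proof (rule poly_mapping_eqI)
  fix k
  have "Poly_Mapping.lookup (vir_bracket x x) k = - Poly_Mapping.lookup (vir_bracket x x) k"
    by (metis vir_bracket_swap lookup_uminus)
  then show "Poly_Mapping.lookup (vir_bracket x x) k = Poly_Mapping.lookup 0 k"
    by simp
qed

lemma vir_bracket_zero [simp]: "vir_bracket 0 x = 0" "vir_bracket x 0 = 0"
  by (simp_all add: vir_bracket_def)

lemma vir_bracket_L_L:
  "vir_bracket (Vir_L i) (Vir_L j) =
     vir_scale (of_int (i - j)) (Vir_L (i + j))
     + (if i + j = 0 then vir_scale (of_int (i ^ 3 - i)) Vir_C else 0)"
  by (simp add: vir_bracket_def Vir_L_def)

lemma vir_bracket_C [simp]: "vir_bracket Vir_C x = 0" "vir_bracket x Vir_C = 0"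
  by (simp_all add: vir_bracket_def Vir_C_def)

lemma vir_expand:
  "x = (\<Sum>a\<in>Poly_Mapping.keys x. vir_scale (Poly_Mapping.lookup x a) (Poly_Mapping.single a 1))"
  by (rule poly_mapping_eqI)
    (auto simp: lookup_sum lookup_single when_def in_keys_iff if_distrib sum.delta' cong: if_cong)

lemma vir_basis_eq: "range (\<lambda>a. Poly_Mapping.single a 1) = insert Vir_C (range Vir_L)"
proof -
  have "UNIV = insert CI (range LI)"
    by (auto intro: vir_index.exhaust)
  then have "range (\<lambda>a. Poly_Mapping.single a (1::complex)) =
      (\<lambda>a. Poly_Mapping.single a 1) ` insert CI (range LI)"
    by simp
  then show ?thesis
    by (simp add: Vir_C_def Vir_L_def image_image)
qed

lemma vir_span: "vir.span (insert Vir_C (range Vir_L)) = UNIV"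
proof -
  have "x \<in> vir.span (insert Vir_C (range Vir_L))" for x
    by (subst vir_expand, intro vir.span_sum vir.span_scale vir.span_base)
      (auto simp flip: vir_basis_eq)
  then show ?thesis by blast
qed

lemma vir_independent: "vir.independent (insert Vir_C (range Vir_L))"
proof -
  have "u (Poly_Mapping.single a 1) = 0"
    if T: "finite T" "T \<subseteq> range (\<lambda>a. Poly_Mapping.single a 1)"
      and z: "(\<Sum>v\<in>T. vir_scale (u v) v) = 0" and a: "Poly_Mapping.single a 1 \<in> T"
    for T and u :: "vir \<Rightarrow> complex" and a
  proof -
    have "0 = Poly_Mapping.lookup (\<Sum>v\<in>T. vir_scale (u v) v) a"
      using z by simp
    also have "\<dots> = (\<Sum>v\<in>T. u v * Poly_Mapping.lookup v a)"
      by (simp add: lookup_sum)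
    also have "\<dots> = (\<Sum>v\<in>{Poly_Mapping.single a 1}. u v * Poly_Mapping.lookup v a)"
    proof (rule sum.mono_neutral_right)
      show "\<forall>v\<in>T - {Poly_Mapping.single a 1}. u v * Poly_Mapping.lookup v a = 0"
      proof
        fix v assume v: "v \<in> T - {Poly_Mapping.single a 1}"
        with T obtain b where "v = Poly_Mapping.single b 1" by blast
        with v show "u v * Poly_Mapping.lookup v a = 0"
          by (auto simp: lookup_single when_def)
      qed
    qed (use T a in auto)
    finally show ?thesis by simp
  qed
  then show ?thesis
    unfolding vir.independent_explicit_module vir_basis_eq[symmetric] by blast
qed

lemma vir_L_inj: "inj Vir_L" "Vir_C \<notin> range Vir_L"
proof -
  have "Poly_Mapping.keys (Vir_L i) = {LI i}" "Poly_Mapping.keys Vir_C = {CI}" for i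
    by (simp_all add: Vir_L_def Vir_C_def)
  then show "inj Vir_L" "Vir_C \<notin> range Vir_L"
    by (metis injI singleton_inject vir_index.inject, metis rangeE singleton_inject vir_index.distinct(1))
qed

lemma vir_all_induct:
  assumes "vir.subspace {x. P x}" "\<And>i. P (Vir_L i)" "P Vir_C"
  shows "P x"
proof -
  have "vir.span (insert Vir_C (range Vir_L)) \<subseteq> {x. P x}"
    by (rule vir.span_minimal) (use assms in auto)
  then show ?thesis using vir_span by auto
qed

lemma vir_jacobi_L:
  "vir_bracket (Vir_L i) (vir_bracket (Vir_L j) (Vir_L k))
   + vir_bracket (Vir_L j) (vir_bracket (Vir_L k) (Vir_L i))
   + vir_bracket (Vir_L k) (vir_bracket (Vir_L i) (Vir_L j)) = 0"
proof -
  have br: "vir_bracket (Vir_L i) (vir_bracket (Vir_L j) (Vir_L k)) =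
      vir_scale (of_int (j - k)) (vir_scale (of_int (i - (j + k))) (Vir_L (i + j + k))
        + (if i + j + k = 0 then vir_scale (of_int (i ^ 3 - i)) Vir_C else 0))" for i j k
    by (simp add: vir_bracket_L_L vir_bracket_add_right vir_bracket_scale_right add.assoc)
  show ?thesis
  proof (cases "i + j + k = 0")
    case True
    then have k: "k = - i - j" by simp
    show ?thesis
      unfolding br by (rule poly_mapping_eqI)
        (simp add: k lookup_add lookup_minus algebra_simps power3_eq_cube)
  next
    case False
    then have "j + k + i \<noteq> 0" "k + i + j \<noteq> 0" by simp_all
    moreover have "j + k + i = i + j + k" "k + i + j = i + j + k" by simp_all
    ultimately show ?thesis
      unfolding br using False by (intro poly_mapping_eqI)
        (simp add: lookup_add algebra_simps)
  qed
qed

lemma vir_jacobi: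
  "vir_bracket x (vir_bracket y z) + vir_bracket y (vir_bracket z x)
   + vir_bracket z (vir_bracket x y) = 0"
proof -
  define J where "J x y z = vir_bracket x (vir_bracket y z) + vir_bracket y (vir_bracket z x)
     + vir_bracket z (vir_bracket x y)" for x y z
  have cyc: "J x y z = J y z x" for x y z
    by (simp add: J_def algebra_simps)
  have sub: "vir.subspace {x. J x y z = 0}" for y z
  proof (rule vir.subspaceI)
    fix u v assume "u \<in> {x. J x y z = 0}" "v \<in> {x. J x y z = 0}"
    moreover have "J (u + v) y z = J u y z + J v y z"
      by (simp add: J_def vir_bracket_add_left vir_bracket_add_right algebra_simps)
    ultimately show "u + v \<in> {x. J x y z = 0}" by simp
  next
    fix c u assume "u \<in> {x. J x y z = 0}"
    moreover have "J (vir_scale c u) y z = vir_scale c (J u y z)"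
      by (simp add: J_def vir_bracket_scale_left vir_bracket_scale_right vir.scale_right_distrib)
    ultimately show "vir_scale c u \<in> {x. J x y z = 0}" by simp
  qed (simp add: J_def)
  have C: "J Vir_C y z = 0" for y z
    by (simp add: J_def)
  have 1: "J x (Vir_L j) (Vir_L k) = 0" for x j k
    by (rule vir_all_induct[OF sub]) (simp_all add: C, simp add: J_def vir_jacobi_L)
  have 2: "J y (Vir_L k) x = 0" for x y k
    by (subst cyc, subst cyc, rule vir_all_induct[OF sub]) (metis 1 cyc, simp add: C)
  have "J x y z = 0"
    by (subst cyc, subst cyc, rule vir_all_induct[OF sub]) (metis 2 cyc, simp add: C)
  then show ?thesis by (simp add: J_def)
qed

interpretation vir: lie_algebra vir_scale vir_bracket
  by unfold_locales
    (fact vir_bracket_add_left vir_bracket_add_right vir_bracket_scale_left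
      vir_bracket_scale_right vir_bracket_self vir_jacobi)+

lemma lookup_vir_bracket_L:
  "Poly_Mapping.lookup (vir_bracket x (Vir_L j)) (LI (i + j)) =
     of_int (i - j) * Poly_Mapping.lookup x (LI i)"
proof -
  have "vir.subspace {x. Poly_Mapping.lookup (vir_bracket x (Vir_L j)) (LI (i + j)) =
     of_int (i - j) * Poly_Mapping.lookup x (LI i)}"
    by (rule vir.subspaceI)
      (auto simp: vir_bracket_add_left vir_bracket_scale_left lookup_add distrib_left
        mult.left_commute)
  then show ?thesis
    by (rule vir_all_induct)
      (auto simp: vir_bracket_L_L lookup_add, auto simp: Vir_L_def Vir_C_def lookup_single when_def)
qed

lemma vir_Ann_eq: "vir.Ann = vir.span {Vir_C}"
proof
  show "vir.span {Vir_C} \<subseteq> vir.Ann"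
    by (auto simp: vir.span_singleton vir.Ann_def vir_bracket_scale_left)
  show "vir.Ann \<subseteq> vir.span {Vir_C}"
  proof
    fix x assume x: "x \<in> vir.Ann"
    have "Poly_Mapping.lookup x (LI i) = 0" for i
      using x lookup_vir_bracket_L[of x "i + 1" i] by (simp add: vir.Ann_def)
    then have "x = vir_scale (Poly_Mapping.lookup x CI) Vir_C"
      by (intro poly_mapping_eqI, rename_tac k, case_tac k) (auto simp: Vir_C_def lookup_single)
    then show "x \<in> vir.span {Vir_C}"
      by (auto simp: vir.span_singleton)
  qed
qed

end

theory Submission
  imports Defs "HOL-Computational_Algebra.Polynomial"
begin

text \<open>
  Directness: if \<open>d + \<phi> + g = 0\<close>, then comparing the associated maps \<open>f'\<close> gives
  \<open>d + 2\<phi> = 0\<close> on brackets, hence everywhere since \<open>Vir\<close> is perfect. So \<open>\<phi> = g\<close> takes central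
  values, thus vanishes on brackets, hence everywhere.

  Generation: let \<open>f\<close> be a quasi-derivation, fix \<open>k\<close>, and let \<open>a i\<close> be the coefficient of \<open>L (i + k)\<close> in
  \<open>f (L i)\<close>. The \<open>L\<close>-components of the defining equation force \<open>a\<close> to be affine in \<open>i\<close>,
  and for \<open>k \<noteq> 0\<close> the \<open>C\<close>-component forces it to be a multiple of \<open>k - i\<close>, as for
  \<open>ad (L k)\<close>. For \<open>k = 0\<close> an affine function is a combination of those of the identity and of
  \<open>ad (L 0)\<close>. Since \<open>f (L 0)\<close> has finite support, \<open>f\<close> agrees modulo the center with
  \<open>\<lambda> id + ad x\<close> for some \<open>x\<close>.
\<close>

section \<open>Quasi-derivations of a perfect Lie algebra\<close>

context lie_algebra
begin

lemma mem_endomorphisms: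
  "f \<in> endomorphisms \<longleftrightarrow> (\<forall>x y. f (x + y) = f x + f y) \<and> (\<forall>c x. f (c *s x) = c *s f x)"
  unfolding endomorphisms_def Vector_Spaces.linear_iff
  by (auto intro: vector_space_axioms)

lemma endomorphism_0: "f \<in> endomorphisms \<Longrightarrow> f 0 = 0"
  by (metis mem_endomorphisms scale_zero_left)

lemma bracket_0 [simp]: "bracket 0 x = 0" "bracket x 0 = 0"
  by (metis bracket_scale_left scale_zero_left, metis bracket_scale_right scale_zero_left)

lemma bracket_swap: "bracket x y = - bracket y x"
proof -
  have "bracket (x + y) (x + y) = bracket x y + bracket y x"
    unfolding bracket_add_left bracket_add_right by (simp add: bracket_self)
  then show ?thesis
    by (simp add: bracket_self eq_neg_iff_add_eq_0)
qed

lemma subspace_endomorphisms: "maps.subspace endomorphisms"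
  by (rule maps.subspaceI)
    (auto simp: mem_endomorphisms pointwise_scale_def scale_right_distrib mult.commute)

lemma subspace_delta_derivations: "maps.subspace (delta_derivations \<delta>)"
proof (rule maps.subspaceI)
  show "0 \<in> delta_derivations \<delta>"
    using maps.subspace_0[OF subspace_endomorphisms] by (simp add: delta_derivations_def)
next
  fix f g assume "f \<in> delta_derivations \<delta>" "g \<in> delta_derivations \<delta>"
  then show "f + g \<in> delta_derivations \<delta>"
    using maps.subspace_add[OF subspace_endomorphisms, of f g]
    by (simp add: delta_derivations_def bracket_add_left bracket_add_right
        scale_right_distrib algebra_simps)
next
  fix c f assume "f \<in> delta_derivations \<delta>"
  then show "pointwise_scale (*s) c f \<in> delta_derivations \<delta>"
    using maps.subspace_scale[OF subspace_endomorphisms, of f c]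
    by (simp add: delta_derivations_def pointwise_scale_def bracket_scale_left
        bracket_scale_right scale_right_distrib mult.commute)
qed

lemma subspace_Ann: "subspace Ann"
  by (rule subspaceI) (auto simp: Ann_def bracket_add_left bracket_scale_left)

lemma subspace_AnnQ: "maps.subspace AnnQ"
proof (rule maps.subspaceI)
  show "0 \<in> AnnQ"
    using maps.subspace_0[OF subspace_endomorphisms] subspace_0[OF subspace_Ann]
    by (auto simp: AnnQ_def)
next
  fix f g assume "f \<in> AnnQ" "g \<in> AnnQ"
  then show "f + g \<in> AnnQ"
    using maps.subspace_add[OF subspace_endomorphisms, of f g]
    by (auto simp: AnnQ_def image_subset_iff intro: subspace_add[OF subspace_Ann])
next
  fix c f assume "f \<in> AnnQ"
  then show "pointwise_scale (*s) c f \<in> AnnQ"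
    using maps.subspace_scale[OF subspace_endomorphisms, of f c]
    by (auto simp: AnnQ_def pointwise_scale_def image_subset_iff
        intro: subspace_scale[OF subspace_Ann])
qed

lemma subspace_quasi_derivations: "maps.subspace quasi_derivations"
proof (rule maps.subspaceI)
  show "0 \<in> quasi_derivations"
    using maps.subspace_0[OF subspace_endomorphisms]
    by (auto simp: quasi_derivations_def intro!: bexI[of _ 0])
next
  fix f g assume "f \<in> quasi_derivations" "g \<in> quasi_derivations"
  then obtain f' g' where *: "f \<in> endomorphisms" "g \<in> endomorphisms"
      "f' \<in> endomorphisms" "g' \<in> endomorphisms"
      "\<And>x y. bracket (f x) y + bracket x (f y) = f' (bracket x y)"
      "\<And>x y. bracket (g x) y + bracket x (g y) = g' (bracket x y)"
    by (auto simp: quasi_derivations_def)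
  then have "bracket ((f + g) x) y + bracket x ((f + g) y) = (f' + g') (bracket x y)" for x y
    by (simp add: bracket_add_left bracket_add_right algebra_simps flip: *(5,6))
  with * show "f + g \<in> quasi_derivations"
    unfolding quasi_derivations_def by (blast intro: maps.subspace_add[OF subspace_endomorphisms])
next
  fix c f assume "f \<in> quasi_derivations"
  then obtain f' where *: "f \<in> endomorphisms" "f' \<in> endomorphisms"
      "\<And>x y. bracket (f x) y + bracket x (f y) = f' (bracket x y)"
    by (auto simp: quasi_derivations_def)
  then have "bracket (pointwise_scale (*s) c f x) y + bracket x (pointwise_scale (*s) c f y) =
      pointwise_scale (*s) c f' (bracket x y)" for x y
    by (simp add: bracket_scale_left bracket_scale_right pointwise_scale_def scale_right_distrib
        flip: *(3))
  with * show "pointwise_scale (*s) c f \<in> quasi_derivations"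
    unfolding quasi_derivations_def by (blast intro: maps.subspace_scale[OF subspace_endomorphisms])
qed

text \<open>The multiple of \<open>f\<close> by \<open>inverse \<delta>\<close> serves as
  \<open>f'\<close>.\<close>

lemma delta_derivations_subset_quasi_derivations:
  assumes "\<delta> \<noteq> 0"
  shows "delta_derivations \<delta> \<subseteq> quasi_derivations"
proof
  fix f assume f: "f \<in> delta_derivations \<delta>"
  then have "pointwise_scale (*s) (inverse \<delta>) f \<in> endomorphisms"
    by (auto simp: delta_derivations_def intro: maps.subspace_scale[OF subspace_endomorphisms])
  moreover have "bracket (f x) y + bracket x (f y) =
      pointwise_scale (*s) (inverse \<delta>) f (bracket x y)" for x y
    using f assms by (simp add: delta_derivations_def pointwise_scale_def)
  ultimately show "f \<in> quasi_derivations"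
    using f by (auto simp: quasi_derivations_def delta_derivations_def)
qed

lemma AnnQ_bracket:
  assumes "f \<in> AnnQ"
  shows "bracket (f x) y = 0" "bracket x (f y) = 0"
proof -
  show *: "bracket (f x) y = 0" for x y
    using assms by (auto simp: AnnQ_def Ann_def)
  show "bracket x (f y) = 0"
    using bracket_swap[of x "f y"] by (simp add: *)
qed

text \<open>Central values vanish in every bracket, so \<open>f' = 0\<close> works.\<close>

lemma AnnQ_subset_quasi_derivations: "AnnQ \<subseteq> quasi_derivations"
proof
  fix f assume f: "f \<in> AnnQ"
  then show "f \<in> quasi_derivations"
    using maps.subspace_0[OF subspace_endomorphisms] AnnQ_bracket[OF f]
    by (auto simp: quasi_derivations_def AnnQ_def intro!: bexI[of _ 0])
qed

lemma ad_in_derivations: "bracket x \<in> derivations"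
proof -
  have "bracket x (bracket y z) = bracket (bracket x y) z + bracket y (bracket x z)" for y z
    using jacobi[of x y z] bracket_swap[of z "bracket x y"] bracket_swap[of z x]
      bracket_scale_right[of y "-1" "bracket x z"]
    by (simp add: algebra_simps add_eq_0_iff)
  then show ?thesis
    by (simp add: derivations_def delta_derivations_def mem_endomorphisms
        bracket_add_right bracket_scale_right)
qed

text \<open>Bilinearity yields \<open>c\<close> times the bracket twice, and the factor 1/2 halves
  it.\<close>

lemma scalar_in_half_derivations: "(*s) c \<in> delta_derivations (1/2)"
proof -
  have "x = (1/2) *s (x + x)" for x
    by (simp add: scale_right_distrib flip: scale_left_distrib)
  then show ?thesis
    by (simp add: delta_derivations_def mem_endomorphisms
        bracket_scale_left bracket_scale_right mult.commute[of c])
     (simp add: scale_right_distrib)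
qed

lemma derivation_half_derivation_AnnQ_direct:
  assumes perfect: "span {bracket x y |x y. True} = UNIV"
    and d: "d \<in> derivations" and p: "p \<in> delta_derivations (1/2)" and g: "g \<in> AnnQ"
    and sum0: "d + p + g = 0"
  shows "d = 0 \<and> p = 0 \<and> g = 0"
proof -
  have vanish: "f = 0" if f: "f \<in> endomorphisms" and f0: "\<And>x y. f (bracket x y) = 0" for f
  proof -
    have "subspace {x. f x = 0}"
      using f by (intro subspaceI) (auto simp: mem_endomorphisms endomorphism_0[OF f])
    then have "span {bracket x y |x y. True} \<subseteq> {x. f x = 0}"
      by (intro span_minimal) (auto simp: f0)
    then show ?thesis
      using perfect by (auto simp: fun_eq_iff)
  qed
  have dend: "d \<in> endomorphisms" and pend: "p \<in> endomorphisms"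
    using d p by (auto simp: derivations_def delta_derivations_def)
  have sum0_at: "d x + p x + g x = 0" for x
    using fun_cong[OF sum0, of x] by simp
  have p2: "p (bracket x y) + p (bracket x y) = bracket (p x) y + bracket x (p y)" for x y
  proof -
    have "p (bracket x y) = (1/2) *s (bracket (p x) y + bracket x (p y))"
      using p by (simp add: delta_derivations_def)
    then show ?thesis
      by (simp flip: scale_left_distrib)
  qed
  have dp: "d + p + p = 0"
  proof (rule vanish)
    show "d + p + p \<in> endomorphisms"
      by (intro maps.subspace_add[OF subspace_endomorphisms] dend pend)
  next
    fix x y
    have "(d + p + p) (bracket x y) =
        (bracket (d x) y + bracket x (d y)) + (bracket (p x) y + bracket x (p y))"
      using d p2[of x y] by (simp add: derivations_def delta_derivations_def add.assoc)
    \<comment> \<open>\<open>g\<close> may be inserted because brackets kill its central values;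
      this brings in the vanishing sum.\<close>
    also have "\<dots> = bracket (d x + p x + g x) y + bracket x (d y + p y + g y)"
      by (simp add: bracket_add_left bracket_add_right AnnQ_bracket[OF g])
    finally show "(d + p + p) (bracket x y) = 0"
      by (simp add: sum0_at)
  qed
  then have "g = p"
    using sum0 by (metis add_left_cancel)
  with g have pAnn: "p \<in> AnnQ"
    by simp
  have "p = 0"
  proof (rule vanish[OF pend])
    fix x y
    show "p (bracket x y) = 0"
      using p AnnQ_bracket[OF pAnn] by (simp add: delta_derivations_def)
  qed
  with dp \<open>g = p\<close> show ?thesis
    by simp
qed

end

section \<open>The coefficient recursion\<close>

lemma poly_eq_0_if_infinitely_many_int_roots:
  fixes p :: "complex poly"
  assumes "\<And>i. i \<ge> N \<Longrightarrow> poly p (of_int i) = 0"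
  shows "p = 0"
proof (rule ccontr)
  assume "p \<noteq> 0"
  then have "finite {x. poly p x = 0}"
    by (rule poly_roots_finite)
  moreover have "of_int ` {N..} \<subseteq> {x. poly p x = 0}"
    using assms by auto
  ultimately have "finite (of_int ` {N..} :: complex set)"
    by (rule finite_subset[rotated])
  then have "finite {N..}"
    by (rule finite_imageD) (auto intro: inj_onI)
  then show False
    using infinite_Ici by blast
qed

lemma quasi_derivation_coefficients_affine:
  fixes a b :: "int \<Rightarrow> complex" and k :: int
  assumes eq: "\<And>i j. i + j \<noteq> 0 \<Longrightarrow>
    of_int (i - j + k) * a i + of_int (i - j - k) * a j = of_int (i - j) * b (i + j)"
  shows "a m = a 0 + of_int m * (a 1 - a 0)"
proof -
  text \<open>
    Eliminating \<open>b\<close> by the instance \<open>j = 0\<close> leaves a homogeneous system solved by all affine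
    functions, so it suffices that a solution \<open>e\<close> with \<open>e 0 = e 1 = 0\<close> vanishes. The equations
    with \<open>j = 1\<close> determine \<open>e i\<close> for large \<open>i\<close> as a rational function of \<open>i\<close> times \<open>h 2\<close>;
    for this function the equations with \<open>j = 2\<close> become a polynomial identity \<open>p = 0\<close> in \<open>i\<close>.
    So \<open>e i = 0\<close> for all large \<open>i\<close>, and any \<open>e m\<close> is tied to \<open>e i\<close> and \<open>e (i + m)\<close>.
  \<close>
  define e where "e i = a i - a 0 - of_int i * (a 1 - a 0)" for i
  have e01: "e 0 = 0" "e 1 = 0"
    by (simp_all add: e_def)
  have E: "of_int (i + j) * (of_int (i - j + k) * e i + of_int (i - j - k) * e j) =
      of_int (i - j) * (of_int (i + j + k) * e (i + j))" if "i + j \<noteq> 0" for i j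
  proof -
    let ?I = "of_int i :: complex" and ?J = "of_int j :: complex" and ?K = "of_int k :: complex"
    have 1: "(?I - ?J + ?K) * a i + (?I - ?J - ?K) * a j - (?I - ?J) * b (i + j) = 0"
      using eq[OF that] by simp
    have 2: "(?I + ?J + ?K) * a (i + j) + (?I + ?J - ?K) * a 0 - (?I + ?J) * b (i + j) = 0"
      using eq[of "i + j" 0] that by simp
    \<comment> \<open>This combination cancels \<open>b\<close>; the affine function subtracted in
      \<open>e\<close> drops out because it solves the same homogeneous relation.\<close>
    have "(?I + ?J) * ((?I - ?J + ?K) * e i + (?I - ?J - ?K) * e j)
        - (?I - ?J) * ((?I + ?J + ?K) * e (i + j)) =
        (?I + ?J) * ((?I - ?J + ?K) * a i + (?I - ?J - ?K) * a j - (?I - ?J) * b (i + j))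
        - (?I - ?J) * ((?I + ?J + ?K) * a (i + j) + (?I + ?J - ?K) * a 0 - (?I + ?J) * b (i + j))"
      by (simp add: e_def algebra_simps)
    then show ?thesis
      unfolding 1 2 by simp
  qed
  \<comment> \<open>The weight absorbs \<open>k\<close>: multiplying the case \<open>j = 1\<close>
    of \<open>E\<close> by \<open>i + k\<close> gives a recursion for \<open>h\<close> whose
    coefficients do not involve \<open>k\<close>.\<close>
  define h where "h i = of_int ((i + k) * (i - 1 + k)) * e i" for i
  have h_rec: "of_int (i + 1) * h i = of_int (i - 1) * h (i + 1)" if "i \<noteq> - 1" for i
  proof -
    have "of_int (i + 1) * (of_int (i - 1 + k) * e i) =
        of_int (i - 1) * (of_int (i + 1 + k) * e (i + 1))"
      using E[of i 1] that by (simp add: e01)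
    then have "of_int (i + k) * (of_int (i + 1) * (of_int (i - 1 + k) * e i)) =
        of_int (i + k) * (of_int (i - 1) * (of_int (i + 1 + k) * e (i + 1)))"
      by (rule arg_cong)
    then show ?thesis
      by (simp add: h_def mult_ac)
  qed
  \<comment> \<open>The induction starts at 2 because its step divides by
    \<open>i - 1\<close>.\<close>
  have h_eq: "2 * h i = of_int (i * (i - 1)) * h 2" if "i \<ge> 2" for i
    using that
  proof (induction i rule: int_ge_induct)
    case (step i)
    then have "of_int (i - 1) * (2 * h (i + 1)) = 2 * (of_int (i + 1) * h i)"
      using h_rec[of i] by simp
    also have "\<dots> = of_int (i + 1) * (of_int (i * (i - 1)) * h 2)"
      by (simp only: step.IH mult.left_commute[of 2])
    also have "\<dots> = of_int (i - 1) * (of_int ((i + 1) * (i + 1 - 1)) * h 2)"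
      by (simp add: mult_ac)
    finally have "of_int (i - 1) * (2 * h (i + 1)) = \<dots>" .
    moreover have "of_int (i - 1) \<noteq> (0::complex)"
      using step.hyps by (subst of_int_eq_0_iff) simp
    ultimately show ?case
      by (metis mult_left_cancel)
  qed simp
  let ?k = "of_int k :: complex"
  \<comment> \<open>The case \<open>j = 2\<close> of \<open>E\<close> times
    \<open>2 * (i + k) * (i + k - 1) * (i + k + 1)\<close>, with \<open>h i\<close> and
    \<open>h (i + 2)\<close> replaced through \<open>h_eq\<close> and the common factor
    \<open>i + 2\<close> removed.\<close>
  define p where "p = smult (h 2) ([:?k - 2, 1:] * [:?k + 1, 1:] * [:0, 1:] * [:-1, 1:])
      + smult (2 * e 2) ([:-2 - ?k, 1:] * [:?k, 1:] * [:?k - 1, 1:] * [:?k + 1, 1:])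
      - smult (h 2) ([:-2, 1:] * [:?k, 1:] * [:?k - 1, 1:] * [:1, 1:])"
  have "p = 0"
  proof (rule poly_eq_0_if_infinitely_many_int_roots)
    fix i :: int assume i: "i \<ge> 3"
    have "of_int (i + 2) * poly p (of_int i) = 0"
      using E[of i 2] h_eq[of i] h_eq[of "i + 2"] i
      unfolding p_def h_def[of i] h_def[of "i + 2"] of_int_add of_int_diff of_int_mult
      by simp algebra
    moreover have "of_int (i + 2) \<noteq> (0::complex)"
      using i by (subst of_int_eq_0_iff) simp
    ultimately show "poly p (of_int i) = 0"
      by (metis mult_eq_0_iff)
  qed
  \<comment> \<open>The two multiples of \<open>h 2\<close> are products of four monic linear
    factors with opposite signs, so their leading terms cancel.\<close>
  moreover have "coeff p 4 = 2 * e 2"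
    by (simp add: p_def numeral_eq_Suc)
  ultimately have "e 2 = 0"
    by simp
  then have h2: "h 2 = 0"
    by (simp add: h_def)
  have large: "e i = 0" if "i \<ge> \<bar>k\<bar> + 2" for i
  proof -
    have "h i = 0"
      using h_eq[of i] h2 that by simp
    moreover have "(i + k) * (i - 1 + k) \<noteq> 0"
      using that by auto
    ultimately show ?thesis
      unfolding h_def mult_eq_0_iff[of "of_int _"] of_int_eq_0_iff by blast
  qed
  \<comment> \<open>Large enough that \<open>i\<close> and \<open>i + m\<close> lie in the vanishing
    range and the factors \<open>i + m\<close> and \<open>i - m - k\<close> of \<open>e m\<close> in
    \<open>E\<close> are nonzero.\<close>
  define i where "i = \<bar>k\<bar> + 2 * \<bar>m\<bar> + 2"
  have "e i = 0" "e (i + m) = 0"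
    by (auto intro!: large simp: i_def)
  moreover have "i + m \<noteq> 0" "i - m - k \<noteq> 0"
    by (auto simp: i_def)
  ultimately have "e m = 0"
    using E[of i m] by (simp only: mult_zero_right add_0 mult_eq_0_iff of_int_eq_0_iff) simp
  then show ?thesis
    by (simp add: e_def diff_eq_eq add.commute)
qed

section \<open>The Virasoro algebra\<close>

text \<open>Only the \<open>L (-j)\<close> component of \<open>x\<close> pairs with
  \<open>L j\<close> to a central term, and \<open>(-j)^3 - (-j) = j - j^3\<close>.\<close>

lemma lookup_vir_bracket_L_CI:
  "Poly_Mapping.lookup (vir_bracket x (Vir_L j)) CI =
     of_int (j - j ^ 3) * Poly_Mapping.lookup x (LI (- j))"
proof -
  have "vir.subspace {x. Poly_Mapping.lookup (vir_bracket x (Vir_L j)) CI =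
     of_int (j - j ^ 3) * Poly_Mapping.lookup x (LI (- j))}"
    by (rule vir.subspaceI)
      (auto simp: vir_bracket_add_left vir_bracket_scale_left lookup_add distrib_left
        mult.left_commute)
  then show ?thesis
    by (rule vir_all_induct)
      (auto simp: vir_bracket_L_L lookup_add add_eq_0_iff,
        auto simp: Vir_L_def Vir_C_def lookup_single when_def)
qed

lemma vir_mem_Ann_iff: "x \<in> vir.Ann \<longleftrightarrow> (\<forall>n. Poly_Mapping.lookup x (LI n) = 0)"
proof
  assume "x \<in> vir.Ann"
  then show "\<forall>n. Poly_Mapping.lookup x (LI n) = 0"
    by (auto simp: vir_Ann_eq vir.span_singleton Vir_C_def lookup_single)
next
  assume x: "\<forall>n. Poly_Mapping.lookup x (LI n) = 0"
  then have "x = vir_scale (Poly_Mapping.lookup x CI) Vir_C"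
    by (intro poly_mapping_eqI, rename_tac k, case_tac k) (auto simp: Vir_C_def lookup_single)
  then show "x \<in> vir.Ann"
    by (auto simp: vir_Ann_eq vir.span_singleton)
qed

lemma vir_perfect: "vir.span {vir_bracket x y |x y. True} = UNIV"
proof -
  let ?S = "vir.span {vir_bracket x y |x y. True}"
  have br: "vir_bracket x y \<in> ?S" for x y
    by (rule vir.span_base) blast
  have L0: "Vir_L 0 \<in> ?S"
  proof -
    have "Vir_L 0 = vir_scale (1/2) (vir_bracket (Vir_L 1) (Vir_L (-1)))"
      by (simp add: vir_bracket_L_L)
    then show ?thesis
      by (metis br vir.span_scale)
  qed
  have L: "Vir_L i \<in> ?S" for i
  proof (cases "i = 0")
    case False
    then have "Vir_L i = vir_scale (1 / of_int i) (vir_bracket (Vir_L i) (Vir_L 0))"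
      by (simp add: vir_bracket_L_L)
    then show ?thesis
      by (metis br vir.span_scale)
  qed (use L0 in simp)
  \<comment> \<open>2 is the least positive index at which the cocycle \<open>i^3 - i\<close> is
    nonzero; its value there is 6.\<close>
  have "Vir_C = vir_scale (1/6) (vir_bracket (Vir_L 2) (Vir_L (-2)) - vir_scale 4 (Vir_L 0))"
    by (simp add: vir_bracket_L_L)
  then have "Vir_C \<in> ?S"
    by (metis br L0 vir.span_scale vir.span_diff)
  with L have "vir.span (insert Vir_C (range Vir_L)) \<subseteq> ?S"
    by (intro vir.span_minimal) auto
  then show ?thesis
    using vir_span by auto
qed

text \<open>\<open>d\<close> is the coefficient of \<open>ad (L k)\<close> and \<open>c\<close> that
  of the identity, which can contribute only in degree 0.\<close>

lemma vir_quasi_derivation_coefficients: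
  assumes f: "f \<in> vir.quasi_derivations"
  obtains c d where "k \<noteq> 0 \<Longrightarrow> c = 0"
    and "\<And>i. Poly_Mapping.lookup (f (Vir_L i)) (LI (i + k)) = c + of_int (k - i) * d"
proof -
  obtain f' where f': "f' \<in> vir.endomorphisms"
    and q: "\<And>x y. vir_bracket (f x) y + vir_bracket x (f y) = f' (vir_bracket x y)"
    using f by (auto simp: vir.quasi_derivations_def)
  define a where "a i = Poly_Mapping.lookup (f (Vir_L i)) (LI (i + k))" for i
  \<comment> \<open>Away from \<open>i + j = 0\<close> the bracket of \<open>L i\<close> and
    \<open>L j\<close> has no central term, so \<open>f'\<close> is only evaluated at
    \<open>L (i + j)\<close>.\<close>
  have q_L: "vir_bracket (f (Vir_L i)) (Vir_L j) - vir_bracket (f (Vir_L j)) (Vir_L i) =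
      vir_scale (of_int (i - j)) (f' (Vir_L (i + j)))" if "i + j \<noteq> 0" for i j
    using q[of "Vir_L i" "Vir_L j"] that f' vir_bracket_swap[of "Vir_L i" "f (Vir_L j)"]
    by (simp add: vir_bracket_L_L vir.mem_endomorphisms)
  have affine: "a i = a 0 + of_int i * (a 1 - a 0)" for i
  proof (rule quasi_derivation_coefficients_affine)
    fix i j :: int assume "i + j \<noteq> 0"
    have "Poly_Mapping.lookup (vir_bracket (f (Vir_L i)) (Vir_L j)) (LI (i + j + k)) =
        of_int (i - j + k) * a i" for i j
      using lookup_vir_bracket_L[of "f (Vir_L i)" j "i + k"] by (simp add: a_def algebra_simps)
    from this[of i j] this[of j i]
      arg_cong[OF q_L[OF \<open>i + j \<noteq> 0\<close>], of "\<lambda>x. Poly_Mapping.lookup x (LI (i + j + k))"]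
    show "of_int (i - j + k) * a i + of_int (i - j - k) * a j =
        of_int (i - j) * Poly_Mapping.lookup (f' (Vir_L (i + j))) (LI (i + j + k))"
      by (simp add: lookup_minus add.commute[of j i]) (simp add: algebra_simps)
  qed
  have vanish: "a 0 = of_int k * (a 0 - a 1)" if k: "k \<noteq> 0"
  proof -
    define \<beta> where "\<beta> = Poly_Mapping.lookup (f' (Vir_L (- k))) CI"
    \<comment> \<open>Taking \<open>j = - i - k\<close> makes both brackets reach \<open>C\<close>
      through \<open>a i\<close> and \<open>a j\<close>, while \<open>i + j = - k\<close> stays
      nonzero.\<close>
    have central: "of_int ((i + k) ^ 3 - (i + k)) * a i + of_int (i ^ 3 - i) * a (- i - k) =
        of_int (2 * i + k) * \<beta>" for i
    proof -
      have "i + (- i - k) \<noteq> 0"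
        using k by simp
      from arg_cong[OF q_L[OF this], of "\<lambda>x. Poly_Mapping.lookup x CI"]
      show ?thesis
        by (simp add: lookup_minus lookup_add lookup_vir_bracket_L_CI a_def \<beta>_def algebra_simps
            power3_eq_cube)
    qed
    have "of_int k * (of_int (k\<^sup>2 - 1) * a 0) = of_int k * \<beta>"
      using central[of 0] by (simp add: algebra_simps power2_eq_square power3_eq_cube)
    then have \<beta>: "\<beta> = of_int (k\<^sup>2 - 1) * a 0"
      using k by simp
    \<comment> \<open>\<open>i = 0\<close> determined \<open>\<beta>\<close>; \<open>i = k\<close>
      is a second, independent condition on the affine \<open>a\<close>.\<close>
    have "6 * of_int k ^ 3 * (a 0 - of_int k * (a 0 - a 1)) = 0"
      using central[of k] affine[of k] affine[of "- k - k"] \<beta>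
      by (simp only: of_int_add of_int_diff of_int_mult of_int_power of_int_minus
          of_int_numeral of_int_1) algebra
    then show ?thesis
      using k by simp
  qed
  show ?thesis
  proof (rule that[of "a 0 - of_int k * (a 0 - a 1)" "a 0 - a 1"])
    fix i
    show "Poly_Mapping.lookup (f (Vir_L i)) (LI (i + k)) =
        a 0 - of_int k * (a 0 - a 1) + of_int (k - i) * (a 0 - a 1)"
      using affine[of i] by (simp add: a_def algebra_simps)
  qed (use vanish in simp)
qed

lemma vir_quasi_derivation_decomposition:
  assumes f: "f \<in> vir.quasi_derivations"
  obtains x c where "f - vir_bracket x - vir_scale c \<in> vir.AnnQ"
proof -
  have fend: "f \<in> vir.endomorphisms"
    using f by (simp add: vir.quasi_derivations_def)
  have "\<exists>c d. (k \<noteq> 0 \<longrightarrow> c = 0) \<and>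
      (\<forall>i. Poly_Mapping.lookup (f (Vir_L i)) (LI (i + k)) = c + of_int (k - i) * d)" for k
    by (rule vir_quasi_derivation_coefficients[OF f, of k]) blast
  then obtain c d where c: "\<And>k. k \<noteq> 0 \<Longrightarrow> c k = 0"
    and cd: "\<And>i k. Poly_Mapping.lookup (f (Vir_L i)) (LI (i + k)) = c k + of_int (k - i) * d k"
    by metis
  \<comment> \<open>For \<open>k \<noteq> 0\<close> the coefficient of \<open>L k\<close> in
    \<open>f (L 0)\<close> is \<open>k * d k\<close>. The index 0 is added separately, as
    \<open>d 0\<close> leaves no trace in \<open>f (L 0)\<close>.\<close>
  have "{k. d k \<noteq> 0} \<subseteq> insert 0 (LI -` Poly_Mapping.keys (f (Vir_L 0)))"
    using cd[of 0] c by (auto simp: in_keys_iff)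
  then have fin: "finite {k. d k \<noteq> 0}"
    by (rule finite_subset) (auto intro!: finite_vimageI injI)
  define x where "x = (\<Sum>k | d k \<noteq> 0. vir_scale (d k) (Vir_L k))"
  have x: "Poly_Mapping.lookup x (LI k) = d k" for k
    using fin by (simp add: x_def Vir_L_def lookup_sum lookup_single when_def
        if_distrib sum.delta cong: if_cong)
  define g where "g = f - vir_bracket x - vir_scale (c 0)"
  have gend: "g \<in> vir.endomorphisms"
    unfolding g_def using fend vir.ad_in_derivations[of x] vir.scalar_in_half_derivations[of "c 0"]
    by (intro vir.maps.subspace_diff[OF vir.subspace_endomorphisms])
      (auto simp: vir.derivations_def vir.delta_derivations_def)
  have "vir.subspace {y. g y \<in> vir.Ann}"
    using gend vir.subspace_0[OF vir.subspace_Ann] vir.subspace_add[OF vir.subspace_Ann]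
      vir.subspace_scale[OF vir.subspace_Ann] vir.endomorphism_0[OF gend]
    by (intro vir.subspaceI) (auto simp: vir.mem_endomorphisms)
  moreover have "g (Vir_L i) \<in> vir.Ann" for i
    unfolding vir_mem_Ann_iff
  proof
    fix n
    have "Poly_Mapping.lookup (g (Vir_L i)) (LI (i + (n - i))) = 0"
      using cd[of i "n - i"] c[of "n - i"] lookup_vir_bracket_L[of x i "n - i"]
      by (cases "n = i")
        (simp_all add: g_def x lookup_minus, simp_all add: Vir_L_def lookup_single)
    then show "Poly_Mapping.lookup (g (Vir_L i)) (LI n) = 0"
      by simp
  qed
  moreover have "g Vir_C \<in> vir.Ann"
  proof -
    have "f Vir_C \<in> vir.Ann"
      using f vir.endomorphism_0
      by (auto simp: vir.quasi_derivations_def vir.Ann_def) (metis add_0_right vir_bracket_C)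
    then show ?thesis
      by (simp add: vir_mem_Ann_iff g_def lookup_minus) (simp add: Vir_C_def lookup_single)
  qed
  ultimately have "g y \<in> vir.Ann" for y
    by (rule vir_all_induct)
  then show ?thesis
    using gend that unfolding g_def vir.AnnQ_def by blast
qed

theorem theorem16:
  shows "vir.maps.internal_direct_sum vir.quasi_derivations
    [vir.derivations, vir.delta_derivations (1/2), vir.AnnQ]"
  unfolding vir.maps.internal_direct_sum_3
proof (intro conjI ballI impI)
  show "vir.maps.subspace vir.derivations"
    unfolding vir.derivations_def by (rule vir.subspace_delta_derivations)
  show "vir.maps.subspace (vir.delta_derivations (1/2))"
    by (rule vir.subspace_delta_derivations)
  show "vir.maps.subspace vir.AnnQ"
    by (rule vir.subspace_AnnQ)
  show "vir.quasi_derivations = {d + p + g |d p g. d \<in> vir.derivations \<and>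
      p \<in> vir.delta_derivations (1/2) \<and> g \<in> vir.AnnQ}" (is "_ = ?S")
  proof
    show "vir.quasi_derivations \<subseteq> ?S"
    proof
      fix f assume "f \<in> vir.quasi_derivations"
      then obtain x c where "f - vir_bracket x - vir_scale c \<in> vir.AnnQ"
        by (rule vir_quasi_derivation_decomposition)
      moreover have "f = vir_bracket x + vir_scale c + (f - vir_bracket x - vir_scale c)"
        by (simp add: algebra_simps)
      ultimately show "f \<in> ?S"
        using vir.ad_in_derivations vir.scalar_in_half_derivations by blast
    qed
    show "?S \<subseteq> vir.quasi_derivations"
      using vir.delta_derivations_subset_quasi_derivations[of 1]
        vir.delta_derivations_subset_quasi_derivations[of "1/2"] vir.AnnQ_subset_quasi_derivations
      by (auto simp: vir.derivations_def
          intro!: vir.maps.subspace_add[OF vir.subspace_quasi_derivations])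
  qed
qed (use vir.derivation_half_derivation_AnnQ_direct[OF vir_perfect] in blast)+

end
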